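(* Let $p<q$ in $\mathbf{R}$. If the function $h\colon[p,q]\to\mathbf{R}$ is difference-of-convex, then its concave deviation is \[ \tfrac12\,(D^2h)^-(p,q), \] that is, one half of the (possibly infinite) mass that the negative part $(D^2h)^-$ of the distributional second derivative of $h$ assigns to the open interval $(p,q)$.
   Context: For an interval $J\subset\mathbf{R}$, a function $h\colon J\to\mathbf{R}$ is difference-of-convex when there exists a convex function $s\colon J\to\mathbf{R}$ such that $h+s$ is also convex. The concave deviation of $h\colon J\to\mathbf{R}$ is the infimum of the Lipschitz constants of convex functions $s\colon J\to\mathbf{R}$ such that $h+s$ is also convex ($+\infty$ if there are no such Lipschitz $s$). Given an open interval $I$ and a convex function $s\colon I\to\mathbf{R}$, the right derivative $s'_+$ is nondecreasing and right-continuous, and $D^2s$ denotes the nonnegative Radon measure on $I$ with $(D^2s)(a,b]=s'_+(b)-s'_+(a)$ for all $a<b$ in $I$. For a difference-of-convex function $h\colon I\to\mathbf{R}$, the distributional second derivative $D^2h$ is the signed Radon measure $D^2(h+s)-D^2s$, for any convex $s\colon I\to\mathbf{R}$ with $h+s$ convex (this is independent of the choice of $s$). By the Hahn decomposition, $D^2h=(D^2h)^+-(D^2h)^-$ uniquely, with $(D^2h)^+$ and $(D^2h)^-$ nonnegative Radon measures supported on disjoint sets. For $h\colon[p,q]\to\mathbf{R}$ these measures are taken on the open interval $I=(p,q)$.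
   Formalization: The formal theorem also assumes h is upper semicontinuous at p and q (no downward jump at an endpoint); without this the claim fails, e.g. h=0 on [p,q), h(q)=-1 is difference-of-convex with zero mass on (p,q) but infinite concave deviation. *)

theory Defs
  imports "HOL-Analysis.Analysis"
begin

definition difference_of_convex :: "real set \<Rightarrow> (real \<Rightarrow> real) \<Rightarrow> bool" where
  "difference_of_convex J h \<longleftrightarrow>
     (\<exists>s. convex_on J s \<and> convex_on J (\<lambda>x. h x + s x))"

text \<open>The infimum runs over all Lipschitz constants of all admissible \<open>s\<close>, which is the same
  as the infimum of the optimal constants; the infimum of the empty set is \<open>\<infinity>\<close>.

  A convex function on \<open>{p..q}\<close> may jump up at an endpoint, so a difference-of-convex \<open>h\<close>
  may jump down there, as does \<open>h x = (if x = q then -1 else 0)\<close>. In that case no continuous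
  convex \<open>s\<close> makes \<open>h + s\<close> convex and the concave deviation is infinite, although the second
  derivative on \<open>{p<..<q}\<close> does not see the jump. A statement that compares the two
  therefore has to assume that \<open>h\<close> is upper semicontinuous at the endpoints.\<close>

definition concave_deviation :: "real set \<Rightarrow> (real \<Rightarrow> real) \<Rightarrow> ennreal" where
  "concave_deviation J h =
     Inf {ennreal L | L s. L-lipschitz_on J s \<and> convex_on J s \<and> convex_on J (\<lambda>x. h x + s x)}"

definition right_deriv :: "(real \<Rightarrow> real) \<Rightarrow> real \<Rightarrow> real" where
  "right_deriv s x = (THE D. (s has_real_derivative D) (at_right x))"

text \<open>Nonnegative Radon measures on an open interval \<open>I\<close>: a Borel measure on \<open>I\<close> that is finite
  on compact sets is automatically regular.\<close>

definition radon_measure_on :: "real set \<Rightarrow> real measure \<Rightarrow> bool" where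
  "radon_measure_on I M \<longleftrightarrow>
     sets M = sets (restrict_space borel I) \<and>
     (\<forall>K. compact K \<and> K \<subseteq> I \<longrightarrow> emeasure M K < \<infinity>)"

definition convex_D2 :: "real set \<Rightarrow> (real \<Rightarrow> real) \<Rightarrow> real measure" where
  "convex_D2 I s =
     (THE M. radon_measure_on I M \<and>
        (\<forall>a\<in>I. \<forall>b\<in>I. a < b \<longrightarrow>
           emeasure M {a<..b} = ennreal (right_deriv s b - right_deriv s a)))"

text \<open>A signed Radon measure on \<open>I\<close> may have infinite positive and negative mass near the ends
  of \<open>I\<close>. It is therefore represented by its real values on the Borel sets that are contained
  in a compact subset of \<open>I\<close>; its values on other sets are irrelevant.\<close>

definition D2 :: "real set \<Rightarrow> (real \<Rightarrow> real) \<Rightarrow> real set \<Rightarrow> real" where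
  "D2 I h A =
     (let s = (SOME s. convex_on I s \<and> convex_on I (\<lambda>x. h x + s x))
      in measure (convex_D2 I (\<lambda>x. h x + s x)) A - measure (convex_D2 I s) A)"

definition hahn_jordan_decomposition ::
    "real set \<Rightarrow> (real set \<Rightarrow> real) \<Rightarrow> real measure \<Rightarrow> real measure \<Rightarrow> bool" where
  "hahn_jordan_decomposition I \<nu> P N \<longleftrightarrow>
     radon_measure_on I P \<and> radon_measure_on I N \<and>
     (\<exists>A B. A \<in> sets (restrict_space borel I) \<and> B \<in> sets (restrict_space borel I) \<and>
        A \<inter> B = {} \<and> emeasure P (I - A) = 0 \<and> emeasure N (I - B) = 0) \<and>
     (\<forall>A K. A \<in> sets borel \<and> compact K \<and> A \<subseteq> K \<and> K \<subseteq> I \<longrightarrow>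
        \<nu> A = measure P A - measure N A)"

definition D2_neg :: "real set \<Rightarrow> (real \<Rightarrow> real) \<Rightarrow> real measure" where
  "D2_neg I h = (THE N. \<exists>P. hahn_jordan_decomposition I (D2 I h) P N)"

end

theory Submission
  imports Defs "HOL-Probability.Distribution_Functions"
begin

text \<open>Write \<open>I\<close> for the open interval and \<open>P - N\<close> for the Hahn-Jordan decomposition of \<open>D\<^sup>2h\<close>
  on \<open>I\<close>, so that \<open>N\<close> is the negative part.

  Lower bound. If \<open>s\<close> and \<open>h + s\<close> are convex then \<open>D\<^sup>2h = D\<^sup>2(h + s) - D\<^sup>2s\<close> is a difference of two
  nonnegative measures, and \<open>N\<close> is minimal among the measures that can be subtracted
  (\<open>hahn_jordan_minimal\<close>), so \<open>N \<le> D\<^sup>2s\<close>. If \<open>s\<close> is \<open>L\<close>-Lipschitz, its right derivative stays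
  between \<open>-L\<close> and \<open>L\<close>, so \<open>D\<^sup>2s\<close> has mass at most \<open>2 L\<close> and \<open>N(I) \<le> 2 L\<close>
  (\<open>hahn_jordan_neg_le_lipschitz\<close>).

  Upper bound. If \<open>N(I)\<close> is finite, let \<open>s\<close> be an antiderivative of \<open>x \<mapsto> N(p, x] - N(I) / 2\<close>.
  It is convex and \<open>N(I) / 2\<close>-Lipschitz, and \<open>D\<^sup>2s = N\<close>. The increments of the right derivative of
  \<open>h + s\<close> are then given by \<open>D\<^sup>2h + N = P \<ge> 0\<close>; a continuous function with nondecreasing right
  derivative is convex (\<open>convex_on_mono_right_derivative\<close>), hence \<open>h + s\<close> is convex on \<open>I\<close>
  (\<open>optimal_convex_summand\<close>). Upper semicontinuity at the endpoints carries convexity over to the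
  closed interval (\<open>convex_on_Icc_if_upper_semicontinuous\<close>).

  The remaining work shows that the measures involved are well defined: a convex function has a
  nondecreasing right-continuous right derivative, whose Stieltjes measure is the unique Radon
  measure with the prescribed increments (\<open>convex_D2\<close>); \<open>D\<^sup>2h\<close> does not depend on the convex
  summand (\<open>D2_eq\<close>); and its Hahn-Jordan decomposition exists, by the Radon-Nikodym theorem
  (\<open>hahn_jordan_exists\<close>), and is unique.\<close>

section \<open>Right derivatives and convexity\<close>

lemma right_derivative_iff:
  "(f has_real_derivative D) (at_right x) \<longleftrightarrow> ((\<lambda>y. (f y - f x) / (y - x)) \<longlongrightarrow> D) (at_right x)"
  by (simp add: has_field_derivative_iff)

lemma right_deriv_eq:
  assumes "(f has_real_derivative D) (at_right x)"
  shows "right_deriv f x = D"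
  unfolding right_deriv_def
proof (rule the_equality)
  show "(f has_real_derivative D) (at_right x)" by (rule assms)
next
  fix E assume "(f has_real_derivative E) (at_right x)"
  with assms show "E = D"
    unfolding right_derivative_iff using tendsto_unique trivial_limit_at_right_real by blast
qed

lemma convex_on_slope_mono:
  fixes f :: "real \<Rightarrow> real"
  assumes "convex_on J f" "x \<in> J" "y \<in> J" "x < t" "t < y"
  shows "(f t - f x) / (t - x) \<le> (f y - f x) / (y - x)"
    and "(f y - f x) / (y - x) \<le> (f y - f t) / (y - t)"
proof -
  have swap: "(f a - f b) / (a - b) = (f b - f a) / (b - a)" for a b
    by (metis minus_diff_eq minus_divide_divide)
  show "(f t - f x) / (t - x) \<le> (f y - f x) / (y - x)"
    "(f y - f x) / (y - x) \<le> (f y - f t) / (y - t)"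
    using convex_on_slope_le[OF assms] by (simp_all add: swap)
qed

context
  fixes J :: "real set" and f :: "real \<Rightarrow> real"
  assumes J: "open J" and f: "convex_on J f"
begin

lemma convex_between: "x \<in> J \<Longrightarrow> y \<in> J \<Longrightarrow> x \<le> t \<Longrightarrow> t \<le> y \<Longrightarrow> t \<in> J"
  using convex_on_imp_convex[OF f] by (metis is_interval_convex_1 mem_is_interval_1_I)

lemma convex_right_derivative:
  assumes x: "x \<in> J"
  shows "(f has_real_derivative right_deriv f x) (at_right x)"
    and "\<And>y. y \<in> J \<Longrightarrow> x < y \<Longrightarrow> right_deriv f x \<le> (f y - f x) / (y - x)"
proof -
  obtain d where d: "d > 0" "\<And>y. dist y x < d \<Longrightarrow> y \<in> J"
    using J x unfolding open_dist by blast
  define w where "w = x - d/2"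
  define z where "z = x + d/2"
  have w: "w \<in> J" "w < x" and z: "z \<in> J" "x < z"
    using d by (auto simp: w_def z_def dist_real_def)
  define S where "S = (\<lambda>y. (f y - f x) / (y - x)) ` {y \<in> J. x < y}"
  define D where "D = Inf S"
  have bdd: "bdd_below S"
  proof (rule bdd_belowI[where m="(f x - f w) / (x - w)"])
    fix r assume "r \<in> S"
    then obtain y where y: "y \<in> J" "x < y" "r = (f y - f x) / (y - x)" by (auto simp: S_def)
    show "(f x - f w) / (x - w) \<le> r"
      using convex_on_slope_mono[OF f \<open>w \<in> J\<close> y(1) \<open>w < x\<close> y(2)] y(3) by linarith
  qed
  have ne: "S \<noteq> {}" using z by (auto simp: S_def)
  have le: "D \<le> (f y - f x) / (y - x)" if "y \<in> J" "x < y" for y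
    unfolding D_def using that by (intro cInf_lower[OF _ bdd]) (auto simp: S_def)
  have "((\<lambda>y. (f y - f x) / (y - x)) \<longlongrightarrow> D) (at_right x)"
  proof (rule order_tendstoI)
    fix a assume "a < D"
    have "\<forall>\<^sub>F y in at_right x. y \<in> {x<..<z}"
      using z(2) by (rule eventually_at_right_real)
    then show "\<forall>\<^sub>F y in at_right x. a < (f y - f x) / (y - x)"
    proof eventually_elim
      case (elim y)
      then have "y \<in> J" using convex_between[OF x z(1)] by auto
      with le[of y] elim \<open>a < D\<close> show ?case by auto
    qed
  next
    fix a assume "D < a"
    then obtain r where "r \<in> S" "r < a" unfolding D_def using ne bdd cInf_less_iff by blast
    then obtain y where y: "y \<in> J" "x < y" "(f y - f x) / (y - x) < a" by (auto simp: S_def)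
    have "\<forall>\<^sub>F t in at_right x. t \<in> {x<..<y}"
      using y(2) by (rule eventually_at_right_real)
    then show "\<forall>\<^sub>F t in at_right x. (f t - f x) / (t - x) < a"
    proof eventually_elim
      case (elim t)
      with convex_on_slope_mono(1)[OF f x y(1)] y(3) show ?case by force
    qed
  qed
  then have D: "(f has_real_derivative D) (at_right x)" by (simp add: right_derivative_iff)
  from right_deriv_eq[OF this] D le show "(f has_real_derivative right_deriv f x) (at_right x)"
    and "\<And>y. y \<in> J \<Longrightarrow> x < y \<Longrightarrow> right_deriv f x \<le> (f y - f x) / (y - x)"
    by auto
qed

lemma convex_slope_le_right_deriv:
  assumes x: "x \<in> J" and y: "y \<in> J" and "x < y"
  shows "(f y - f x) / (y - x) \<le> right_deriv f y"
proof -
  obtain d where d: "d > 0" "\<And>t. dist t y < d \<Longrightarrow> t \<in> J"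
    using J y unfolding open_dist by blast
  have "\<forall>\<^sub>F t in at_right y. t \<in> {y<..<y+d}"
    using d by (intro eventually_at_right_real) simp
  then have "\<forall>\<^sub>F t in at_right y. (f y - f x) / (y - x) \<le> (f t - f y) / (t - y)"
  proof eventually_elim
    case (elim t)
    then have "t \<in> J" "y < t" using d(2)[of t] by (auto simp: dist_real_def)
    with convex_on_slope_mono[OF f x _ \<open>x < y\<close>, of t] show ?case by linarith
  qed
  with convex_right_derivative(1)[OF y] show ?thesis
    unfolding right_derivative_iff by (rule tendsto_lowerbound) simp
qed

lemma convex_right_deriv_mono:
  assumes "x \<in> J" "y \<in> J" "x \<le> y"
  shows "right_deriv f x \<le> right_deriv f y"
proof (cases "x = y")
  case False
  with assms have "x < y" by simp
  from convex_right_derivative(2)[OF assms(1,2) this]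
    convex_slope_le_right_deriv[OF assms(1,2) this]
  show ?thesis by linarith
qed simp

lemma convex_right_deriv_right_continuous:
  assumes x: "x \<in> J"
  shows "continuous (at_right x) (right_deriv f)"
  unfolding continuous_within
proof (rule order_tendstoI)
  obtain d where d: "d > 0" "\<And>t. dist t x < d \<Longrightarrow> t \<in> J"
    using J x unfolding open_dist by blast
  have ev: "\<forall>\<^sub>F t in at_right x. t \<in> {x<..<x+d}"
    using d by (intro eventually_at_right_real) simp
  {
    fix a assume "a < right_deriv f x"
    from ev show "\<forall>\<^sub>F t in at_right x. a < right_deriv f t"
    proof eventually_elim
      case (elim t)
      then have "t \<in> J" "x < t" using d(2)[of t] by (auto simp: dist_real_def)
      with convex_right_deriv_mono[OF x, of t] \<open>a < _\<close> show ?case by simp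
    qed
  }
  fix a assume "right_deriv f x < a"
  with convex_right_derivative(1)[OF x]
  have "\<forall>\<^sub>F y in at_right x. (f y - f x) / (y - x) < a"
    unfolding right_derivative_iff by (rule order_tendstoD(2))
  with ev have "\<forall>\<^sub>F y in at_right x. y \<in> J \<and> x < y \<and> (f y - f x) / (y - x) < a"
  proof eventually_elim
    case (elim t)
    then show ?case using d(2)[of t] by (auto simp: dist_real_def)
  qed
  then obtain y where y: "y \<in> J" "x < y" "(f y - f x) / (y - x) < a"
    using eventually_happens trivial_limit_at_right_real by blast
  \<comment> \<open>The slope over a chord to \<open>y\<close> is continuous in its left end and bounds \<open>right_deriv\<close> there.\<close>
  have "continuous_on J f" using convex_on_continuous[OF J f] .
  then have "isCont f x" using J x continuous_on_eq_continuous_at by blast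
  then have "((\<lambda>t. (f y - f t) / (y - t)) \<longlongrightarrow> (f y - f x) / (y - x)) (at_right x)"
    using y(2) by (auto intro!: tendsto_intros filterlim_at_within_not_equal
        simp: isCont_def intro: tendsto_within_subset)
  then have "\<forall>\<^sub>F t in at_right x. (f y - f t) / (y - t) < a"
    using y(3) by (rule order_tendstoD(2))
  moreover have "\<forall>\<^sub>F t in at_right x. t \<in> {x<..<y}"
    using y(2) by (rule eventually_at_right_real)
  ultimately show "\<forall>\<^sub>F t in at_right x. right_deriv f t < a"
  proof eventually_elim
    case (elim t)
    then have "t \<in> J" using convex_between[OF x y(1)] by auto
    with convex_right_derivative(2)[OF this y(1)] elim show ?case by auto
  qed
qed

end

text \<open>The mean value inequality for right derivatives. A violation at \<open>b\<close> is traced to the last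
  point \<open>c\<close> at which the inequality, relaxed to the slope \<open>K + e\<close>, still holds: there the right
  derivative would have to be at least \<open>K + e\<close>.\<close>

lemma increment_le_of_right_derivative_le:
  fixes f :: "real \<Rightarrow> real"
  assumes "a \<le> b" and cont: "continuous_on {a..b} f"
    and deriv: "\<And>x. x \<in> {a..<b} \<Longrightarrow> (f has_real_derivative f' x) (at_right x)"
    and le: "\<And>x. x \<in> {a..<b} \<Longrightarrow> f' x \<le> K"
  shows "f b - f a \<le> K * (b - a)"
proof (rule ccontr)
  assume neg: "\<not> ?thesis"
  with \<open>a \<le> b\<close> have "a < b" by (cases "a = b") auto
  define r where "r = (f b - f a - K * (b - a)) / 2"
  define e where "e = r / (b - a)"
  have e: "e > 0" using neg \<open>a < b\<close> by (simp add: e_def r_def)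
  define g where "g x = f x - f a - (K + e) * (x - a)" for x
  have "e * (b - a) = r" using \<open>a < b\<close> by (simp add: e_def)
  then have gb: "g b > 0" using neg by (simp add: g_def distrib_right r_def)
  have contg: "continuous_on {a..b} g" unfolding g_def by (intro continuous_intros cont)
  define S where "S = {x \<in> {a..b}. g x \<le> 0}"
  have "compact S"
  proof -
    have "closed S"
      unfolding S_def by (intro continuous_on_closed_Collect_le contg continuous_intros)
    moreover have "S \<subseteq> {a..b}" by (auto simp: S_def)
    ultimately show ?thesis by (metis compact_Icc compact_Int_closed inf.absorb2)
  qed
  moreover have "a \<in> S" using \<open>a < b\<close> by (simp add: S_def g_def)
  ultimately obtain c where c: "c \<in> S" "\<And>x. x \<in> S \<Longrightarrow> x \<le> c"
    using compact_attains_sup[of S] by blast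
  have cb: "a \<le> c" "c < b" "g c \<le> 0" using c(1) gb by (auto simp: S_def less_le)
  then have "(f has_real_derivative f' c) (at_right c)" by (intro deriv) auto
  then have "(g has_real_derivative f' c - (K + e)) (at_right c)"
    unfolding g_def by (auto intro!: derivative_eq_intros)
  moreover have "\<forall>\<^sub>F x in at_right c. x \<in> {c<..<b}"
    using cb(2) by (rule eventually_at_right_real)
  then have "\<forall>\<^sub>F x in at_right c. 0 \<le> (g x - g c) / (x - c)"
  proof eventually_elim
    case (elim x)
    then have "x \<notin> S" using c(2)[of x] by auto
    with elim cb show ?case by (auto simp: S_def)
  qed
  ultimately have "0 \<le> f' c - (K + e)"
    unfolding right_derivative_iff by (rule tendsto_lowerbound) simp
  with le[of c] cb e show False by auto
qed

text \<open>A function with a supporting line at every point is convex.\<close>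

lemma convex_on_subgradientI:
  fixes f :: "real \<Rightarrow> real"
  assumes "convex J" and sub: "\<And>x y. x \<in> J \<Longrightarrow> y \<in> J \<Longrightarrow> f x + g x * (y - x) \<le> f y"
  shows "convex_on J f"
proof (rule convex_onI[OF _ \<open>convex J\<close>])
  fix t x y :: real assume t: "0 < t" "t < 1" and xy: "x \<in> J" "y \<in> J"
  define z where "z = (1 - t) *\<^sub>R x + t *\<^sub>R y"
  have z: "z \<in> J" unfolding z_def using convexD_alt[OF \<open>convex J\<close> xy] t by simp
  have "(1 - t) * (f z + g z * (x - z)) + t * (f z + g z * (y - z)) \<le> (1 - t) * f x + t * f y"
    using t by (intro add_mono mult_left_mono sub z xy) auto
  moreover have "(1 - t) * (f z + g z * (x - z)) + t * (f z + g z * (y - z)) = f z"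
    by (simp add: z_def algebra_simps)
  ultimately show "f ((1 - t) *\<^sub>R x + t *\<^sub>R y) \<le> (1 - t) * f x + t * f y"
    by (simp add: z_def)
qed

lemma convex_on_mono_right_derivative:
  fixes f :: "real \<Rightarrow> real"
  assumes J: "convex J" and cont: "continuous_on J f"
    and deriv: "\<And>x. x \<in> J \<Longrightarrow> (f has_real_derivative f' x) (at_right x)"
    and mono: "\<And>x y. x \<in> J \<Longrightarrow> y \<in> J \<Longrightarrow> x \<le> y \<Longrightarrow> f' x \<le> f' y"
  shows "convex_on J f"
proof (rule convex_on_subgradientI[OF J])
  fix x y assume xy: "x \<in> J" "y \<in> J"
  have sub: "{a..b} \<subseteq> J" if "a \<in> J" "b \<in> J" for a b
    using J that by (meson atLeastAtMost_iff is_interval_convex_1 mem_is_interval_1_I subsetI)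
  show "f x + f' x * (y - x) \<le> f y"
  proof (cases "x \<le> y")
    case True
    have "(- f y) - (- f x) \<le> (- f' x) * (y - x)"
      using sub[OF xy] True xy
      by (intro increment_le_of_right_derivative_le[where f'="\<lambda>t. - f' t"])
        (auto intro!: continuous_intros continuous_on_subset[OF cont] derivative_intros deriv mono)
    then show ?thesis by simp
  next
    case False
    have "f x - f y \<le> f' x * (x - y)"
      using sub[OF xy(2,1)] False xy
      by (intro increment_le_of_right_derivative_le[where f'="f'"])
        (auto intro!: continuous_on_subset[OF cont] deriv mono)
    then show ?thesis by (simp add: algebra_simps)
  qed
qed

section \<open>Radon measures on a bounded open interval\<close>

text \<open>The logistic chart identifies the interval with the real line, where Borel measures are
  determined by, and can be constructed from, their values on half-open intervals.\<close>

lemma logistic_chart: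
  fixes p q :: real
  assumes "p < q"
  obtains \<phi> \<psi> :: "real \<Rightarrow> real"
  where "\<And>u. \<phi> u \<in> {p<..<q}" "\<And>u. \<psi> (\<phi> u) = u" "\<And>x. x \<in> {p<..<q} \<Longrightarrow> \<phi> (\<psi> x) = x"
    "\<And>u v. \<phi> u < \<phi> v \<longleftrightarrow> u < v" "continuous_on UNIV \<phi>" "continuous_on {p<..<q} \<psi>"
proof
  define \<phi> where "\<phi> u = (p + q * exp u) / (1 + exp u)" for u :: real
  define \<psi> where "\<psi> x = ln ((x - p) / (q - x))" for x
  have pos: "1 + exp u > 0" for u :: real by (simp add: add_pos_pos)
  have lo: "\<phi> u - p = (q - p) * exp u / (1 + exp u)"
    and hi: "q - \<phi> u = (q - p) / (1 + exp u)" for u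
    using pos[of u] by (simp_all add: \<phi>_def diff_divide_eq_iff divide_diff_eq_iff algebra_simps)
  have "\<phi> u - p > 0" "q - \<phi> u > 0" for u
    unfolding lo hi using pos[of u] assms by simp_all
  then show "\<phi> u \<in> {p<..<q}" for u by simp
  show "\<psi> (\<phi> u) = u" for u
    unfolding \<psi>_def lo hi using pos[of u] assms by simp
  show "\<phi> (\<psi> x) = x" if x: "x \<in> {p<..<q}" for x
  proof -
    have "exp (\<psi> x) = (x - p) / (q - x)" using x by (simp add: \<psi>_def)
    moreover have "1 + (x - p) / (q - x) = (q - p) / (q - x)" using x by (simp add: field_simps)
    moreover have "p + q * ((x - p) / (q - x)) = x * (q - p) / (q - x)"
      using x by (simp add: field_simps)
    ultimately show ?thesis using x assms by (simp add: \<phi>_def)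
  qed
  have less: "\<phi> u < \<phi> v" if "u < v" for u v
  proof -
    have "(q - p) * (exp v - exp u) > 0" using assms that by simp
    then have "(p + q * exp u) * (1 + exp v) < (p + q * exp v) * (1 + exp u)"
      by (simp add: algebra_simps)
    then show ?thesis unfolding \<phi>_def using pos[of u] pos[of v]
      by (simp only: divide_less_eq less_divide_eq times_divide_eq_left if_True)
  qed
  show "\<phi> u < \<phi> v \<longleftrightarrow> u < v" for u v
    using less[of u v] less[of v u] by (cases u v rule: linorder_cases) auto
  show "continuous_on UNIV \<phi>"
    unfolding \<phi>_def using pos by (intro continuous_intros) (auto simp: less_imp_neq[symmetric])
  show "continuous_on {p<..<q} \<psi>"
    unfolding \<psi>_def by (intro continuous_intros) auto
qed

lemma compact_subset_Ioc:
  fixes p q :: real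
  assumes "p < q" "compact K" "K \<subseteq> {p<..<q}"
  obtains a b where "a \<in> {p<..<q}" "b \<in> {p<..<q}" "a < b" "K \<subseteq> {a<..b}"
proof (cases "K = {}")
  case True
  have "(2 * p + q) / 3 \<in> {p<..<q}" "(p + 2 * q) / 3 \<in> {p<..<q}" "(2 * p + q) / 3 < (p + 2 * q) / 3"
    using assms(1) by auto
  with True that show ?thesis by blast
next
  case False
  obtain x where x: "x \<in> K" "\<And>t. t \<in> K \<Longrightarrow> x \<le> t"
    using compact_attains_inf[OF assms(2) False] by blast
  obtain y where y: "y \<in> K" "\<And>t. t \<in> K \<Longrightarrow> t \<le> y"
    using compact_attains_sup[OF assms(2) False] by blast
  define a where "a = (p + x) / 2"
  have "p < x" "y \<in> {p<..<q}" "x \<le> y" using x y assms(3) by auto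
  then have a: "a \<in> {p<..<q}" "y \<in> {p<..<q}" "a < y" "a < x" by (auto simp: a_def)
  have "K \<subseteq> {a<..y}"
  proof
    fix t assume "t \<in> K"
    with x(2) y(2) a(4) show "t \<in> {a<..y}" by fastforce
  qed
  with that a(1-3) show ?thesis by blast
qed

text \<open>The bounded open interval \<open>I\<close> that carries all measures below.\<close>

locale bounded_open_interval =
  fixes p q :: real and I :: "real set"
  assumes pq: "p < q" and I_def: "I = {p<..<q}"
begin

lemma sets_radonD:
  assumes "radon_measure_on I M"
  shows "sets M = sets (restrict_space borel I)" "space M = I"
proof -
  show *: "sets M = sets (restrict_space borel I)" using assms by (simp add: radon_measure_on_def)
  show "space M = I" using sets_eq_imp_space_eq[OF *] by (simp add: space_restrict_space)
qed

lemma sets_radon_iff: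
  assumes "radon_measure_on I M"
  shows "E \<in> sets M \<longleftrightarrow> E \<in> sets borel \<and> E \<subseteq> I"
  unfolding sets_radonD(1)[OF assms] by (auto simp: sets_restrict_space_iff I_def)

lemma Ioc_subset: "a \<in> I \<Longrightarrow> b \<in> I \<Longrightarrow> {a<..b} \<subseteq> I" "a \<in> I \<Longrightarrow> b \<in> I \<Longrightarrow> {a..b} \<subseteq> I"
  by (auto simp: I_def)

lemma radon_finite_on_subset_compact:
  assumes "radon_measure_on I M" "compact K" "K \<subseteq> I" "E \<subseteq> K"
  shows "emeasure M E < \<infinity>"
proof -
  have "emeasure M E \<le> emeasure M K"
    using assms by (intro emeasure_mono) (simp_all add: sets_radon_iff borel_compact)
  also have "\<dots> < \<infinity>" using assms by (simp add: radon_measure_on_def)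
  finally show ?thesis .
qed

lemma radon_finite_Ioc:
  assumes "radon_measure_on I M" "a \<in> I" "b \<in> I"
  shows "emeasure M {a<..b} < \<infinity>"
  using assms Ioc_subset(2)[of a b]
  by (intro radon_finite_on_subset_compact[where K="{a..b}"]) auto

lemma radon_measure_onI:
  assumes "sets M = sets (restrict_space borel I)"
    and "\<And>a b. a \<in> I \<Longrightarrow> b \<in> I \<Longrightarrow> a < b \<Longrightarrow> emeasure M {a<..b} < \<infinity>"
  shows "radon_measure_on I M"
  unfolding radon_measure_on_def
proof (intro conjI allI impI assms(1))
  fix K assume K: "compact K \<and> K \<subseteq> I"
  then obtain a b where ab: "a \<in> I" "b \<in> I" "a < b" "K \<subseteq> {a<..b}"
    using compact_subset_Ioc[OF pq] unfolding I_def by metis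
  have "{a<..b} \<in> sets M" using Ioc_subset(1)[OF ab(1,2)]
    by (auto simp: assms(1) sets_restrict_space_iff I_def)
  then have "emeasure M K \<le> emeasure M {a<..b}" by (intro emeasure_mono ab)
  also have "\<dots> < \<infinity>" by (intro assms ab)
  finally show "emeasure M K < \<infinity>" .
qed

lemma radon_measure_eqI:
  assumes M: "radon_measure_on I M" and N: "radon_measure_on I N"
    and eq: "\<And>a b. a \<in> I \<Longrightarrow> b \<in> I \<Longrightarrow> a < b \<Longrightarrow> emeasure M {a<..b} = emeasure N {a<..b}"
  shows "M = N"
proof -
  obtain \<phi> \<psi> :: "real \<Rightarrow> real" where
    chart: "\<And>u. \<phi> u \<in> I" "\<And>u. \<psi> (\<phi> u) = u" "\<And>x. x \<in> I \<Longrightarrow> \<phi> (\<psi> x) = x"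
    "\<And>u v. \<phi> u < \<phi> v \<longleftrightarrow> u < v" "continuous_on UNIV \<phi>" "continuous_on I \<psi>"
    using logistic_chart[OF pq] unfolding I_def by metis
  have \<phi>: "\<phi> \<in> borel \<rightarrow>\<^sub>M restrict_space borel I"
    using chart(1,5) by (intro measurable_restrict_space2 borel_measurable_continuous_onI) auto
  have \<psi>: "\<psi> \<in> restrict_space borel I \<rightarrow>\<^sub>M borel"
    using chart(6) by (intro borel_measurable_continuous_on_restrict)
  have meas: "\<psi> \<in> L \<rightarrow>\<^sub>M borel" if "radon_measure_on I L" for L
    using \<psi> measurable_cong_sets[OF sets_radonD(1)[OF that] refl] by blast
  have inverse: "distr (distr L borel \<psi>) (restrict_space borel I) \<phi> = L" if L: "radon_measure_on I L" for L
  proof -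
    have "distr (distr L borel \<psi>) (restrict_space borel I) \<phi> = distr L (restrict_space borel I) (\<phi> \<circ> \<psi>)"
      by (rule distr_distr[OF \<phi> meas[OF L]])
    also have "\<dots> = distr L L (\<lambda>x. x)"
      using sets_radonD[OF L] chart(3) by (intro distr_cong) auto
    finally show ?thesis by simp
  qed
  have Ioc: "emeasure (distr L borel \<psi>) {u<..v} = emeasure L {\<phi> u<..\<phi> v}"
    if L: "radon_measure_on I L" for L u v
  proof -
    have le: "\<phi> s \<le> \<phi> t \<longleftrightarrow> s \<le> t" for s t using chart(4)[of t s] by linarith
    have "\<psi> -` {u<..v} \<inter> I = {\<phi> u<..\<phi> v}"
    proof (intro set_eqI iffI)
      fix x assume "x \<in> \<psi> -` {u<..v} \<inter> I"
      then show "x \<in> {\<phi> u<..\<phi> v}"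
        using chart(3)[of x] chart(4)[of u "\<psi> x"] le[of "\<psi> x" v] by auto
    next
      fix x assume x: "x \<in> {\<phi> u<..\<phi> v}"
      then have "x \<in> I" using Ioc_subset(1)[OF chart(1) chart(1)] by blast
      then show "x \<in> \<psi> -` {u<..v} \<inter> I"
        using x chart(3)[of x] chart(4)[of u "\<psi> x"] le[of "\<psi> x" v] by auto
    qed
    then show ?thesis using meas[OF L] sets_radonD[OF L] by (simp add: emeasure_distr)
  qed
  have "distr M borel \<psi> = distr N borel \<psi>"
  proof (rule measure_eqI_generator_eq[where \<Omega>=UNIV and E="range (\<lambda>(a, b). {a<..b::real})"
        and A="\<lambda>n. {- real n<..real n}"])
    show "Int_stable (range (\<lambda>(a, b). {a<..b::real}))"
      by (auto simp: Int_stable_def)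
    show "emeasure (distr M borel \<psi>) X = emeasure (distr N borel \<psi>) X"
      if X: "X \<in> range (\<lambda>(a, b). {a<..b})" for X
    proof -
      obtain a b where X: "X = {a<..b}" using X by auto
      show ?thesis
        using Ioc[OF M, of a b] Ioc[OF N, of a b] eq[OF chart(1) chart(1), of a b]
        by (cases "a < b") (auto simp: X chart(4))
    qed
    show "emeasure (distr M borel \<psi>) {- real n<..real n} \<noteq> \<infinity>" for n
      using radon_finite_Ioc[OF M chart(1) chart(1)] by (simp add: Ioc[OF M] less_top)
    show "(\<Union>n. {- real n<..real n}) = UNIV" by (rule UN_Ioc_eq_UNIV)
  qed (auto simp: borel_sigma_sets_Ioc)
  with inverse[OF M] inverse[OF N] show ?thesis by metis
qed

lemma radon_measure_exists:
  assumes mono: "\<And>x y. x \<in> I \<Longrightarrow> y \<in> I \<Longrightarrow> x \<le> y \<Longrightarrow> F x \<le> F y"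
    and cont: "\<And>x. x \<in> I \<Longrightarrow> continuous (at_right x) F"
  shows "\<exists>M. radon_measure_on I M \<and>
    (\<forall>a\<in>I. \<forall>b\<in>I. a < b \<longrightarrow> emeasure M {a<..b} = ennreal (F b - F a))"
proof -
  obtain \<phi> \<psi> :: "real \<Rightarrow> real" where
    chart: "\<And>u. \<phi> u \<in> I" "\<And>u. \<psi> (\<phi> u) = u" "\<And>x. x \<in> I \<Longrightarrow> \<phi> (\<psi> x) = x"
    "\<And>u v. \<phi> u < \<phi> v \<longleftrightarrow> u < v" "continuous_on UNIV \<phi>" "continuous_on I \<psi>"
    using logistic_chart[OF pq] unfolding I_def by metis
  have le: "\<phi> s \<le> \<phi> t \<longleftrightarrow> s \<le> t" for s t using chart(4)[of t s] by linarith
  have \<phi>: "\<phi> \<in> borel \<rightarrow>\<^sub>M restrict_space borel I"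
    using chart(1,5) by (intro measurable_restrict_space2 borel_measurable_continuous_onI) auto
  define G where "G = F \<circ> \<phi>"
  have monoG: "G u \<le> G v" if "u \<le> v" for u v
    using mono[OF chart(1) chart(1)] that le by (simp add: G_def)
  have contG: "continuous (at_right u) G" for u
  proof -
    have "filterlim \<phi> (at_right (\<phi> u)) (at_right u)"
    proof (subst filterlim_at, intro conjI)
      show "\<forall>\<^sub>F v in at_right u. \<phi> v \<in> {\<phi> u<..} \<and> \<phi> v \<noteq> \<phi> u"
        using eventually_at_right_less[of u]
      proof eventually_elim
        case (elim v)
        then have "\<phi> u < \<phi> v" by (simp add: chart(4))
        then show ?case by simp
      qed
      have "isCont \<phi> u" using chart(5) continuous_on_eq_continuous_at[OF open_UNIV] by blast
      then show "(\<phi> \<longlongrightarrow> \<phi> u) (at_right u)"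
        unfolding isCont_def by (rule tendsto_within_subset) simp
    qed
    moreover have "(F \<longlongrightarrow> F (\<phi> u)) (at_right (\<phi> u))"
      using cont[OF chart(1)] by (simp add: continuous_within)
    ultimately have "((\<lambda>v. F (\<phi> v)) \<longlongrightarrow> F (\<phi> u)) (at_right u)"
      by (rule filterlim_compose[rotated])
    then show ?thesis by (simp add: continuous_within G_def comp_def)
  qed
  define M where "M = distr (interval_measure G) (restrict_space borel I) \<phi>"
  have sets: "sets M = sets (restrict_space borel I)" by (simp add: M_def)
  have Ioc: "emeasure M {a<..b} = ennreal (F b - F a)" if ab: "a \<in> I" "b \<in> I" "a < b" for a b
  proof -
    have "a < \<phi> u \<longleftrightarrow> \<psi> a < u" "\<phi> u \<le> b \<longleftrightarrow> u \<le> \<psi> b" for u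
      using chart(3)[OF ab(1)] chart(3)[OF ab(2)] chart(4)[of "\<psi> a" u] le[of u "\<psi> b"]
      by simp_all
    then have vim: "\<phi> -` {a<..b} = {\<psi> a<..\<psi> b}"
      by (intro set_eqI) simp
    have "{a<..b} \<in> sets (restrict_space borel I)"
      using Ioc_subset(1)[OF ab(1,2)] by (auto simp: sets_restrict_space_iff I_def)
    then have "emeasure M {a<..b} = emeasure (interval_measure G) {\<psi> a<..\<psi> b}"
      unfolding M_def using \<phi> by (simp add: emeasure_distr vim)
    also have "\<dots> = ennreal (G (\<psi> b) - G (\<psi> a))"
    proof (rule emeasure_interval_measure_Ioc[OF _ monoG contG])
      show "\<psi> a \<le> \<psi> b" using ab chart(3)[OF ab(1)] chart(3)[OF ab(2)] le[of "\<psi> a" "\<psi> b"] by simp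
    qed
    finally show ?thesis using ab chart(3) by (simp add: G_def)
  qed
  have "radon_measure_on I M" by (rule radon_measure_onI[OF sets]) (simp add: Ioc)
  with Ioc show ?thesis by (intro exI[of _ M]) simp
qed

lemma convex_D2:
  assumes f: "convex_on I f"
  shows "radon_measure_on I (convex_D2 I f)"
    and "\<And>a b. a \<in> I \<Longrightarrow> b \<in> I \<Longrightarrow> a < b \<Longrightarrow>
      emeasure (convex_D2 I f) {a<..b} = ennreal (right_deriv f b - right_deriv f a)"
proof -
  let ?P = "\<lambda>M. radon_measure_on I M \<and> (\<forall>a\<in>I. \<forall>b\<in>I. a < b \<longrightarrow>
           emeasure M {a<..b} = ennreal (right_deriv f b - right_deriv f a))"
  have "open I" by (simp add: I_def)
  obtain M where M: "?P M"
    using radon_measure_exists[OF convex_right_deriv_mono[OF \<open>open I\<close> f]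
      convex_right_deriv_right_continuous[OF \<open>open I\<close> f]] ..
  have "?P (convex_D2 I f)"
    unfolding convex_D2_def
  proof (rule theI[where P="?P", OF M])
    fix N assume "?P N"
    with M show "N = M" by (intro radon_measure_eqI) auto
  qed
  then show "radon_measure_on I (convex_D2 I f)"
    and "\<And>a b. a \<in> I \<Longrightarrow> b \<in> I \<Longrightarrow> a < b \<Longrightarrow>
      emeasure (convex_D2 I f) {a<..b} = ennreal (right_deriv f b - right_deriv f a)"
    by blast+
qed

end

section \<open>The Hahn decomposition\<close>

text \<open>The sum of two measures on the same \<open>\<sigma>\<close>-algebra, which is taken from the first one.\<close>

definition sum_measure :: "'a measure \<Rightarrow> 'a measure \<Rightarrow> 'a measure" where
  "sum_measure M N = measure_of (space M) (sets M) (\<lambda>A. emeasure M A + emeasure N A)"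

lemma sets_sum_measure [simp]: "sets (sum_measure M N) = sets M"
  by (simp add: sum_measure_def)

lemma emeasure_sum_measure:
  assumes sets: "sets N = sets M" and A: "A \<in> sets M"
  shows "emeasure (sum_measure M N) A = emeasure M A + emeasure N A"
  unfolding sum_measure_def
proof (rule emeasure_measure_of_sigma[OF sets.sigma_algebra_axioms _ _ A])
  show "positive (sets M) (\<lambda>A. emeasure M A + emeasure N A)"
    by (simp add: positive_def)
  show "countably_additive (sets M) (\<lambda>A. emeasure M A + emeasure N A)"
  proof (rule countably_additiveI)
    fix F :: "nat \<Rightarrow> _" assume F: "range F \<subseteq> sets M" "disjoint_family F"
    have "(\<Sum>i. emeasure M (F i) + emeasure N (F i)) = (\<Sum>i. emeasure M (F i)) + (\<Sum>i. emeasure N (F i))"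
      by (intro suminf_add[symmetric] summableI)
    also have "\<dots> = emeasure M (\<Union>i. F i) + emeasure N (\<Union>i. F i)"
      using F sets by (simp add: suminf_emeasure)
    finally show "(\<Sum>i. emeasure M (F i) + emeasure N (F i)) = emeasure M (\<Union>i. F i) + emeasure N (\<Union>i. F i)" .
  qed
qed

context bounded_open_interval
begin

text \<open>The interval is an increasing union of half-open intervals with compact hull in it.\<close>

lemma Ioc_exhaustion:
  obtains c d :: "nat \<Rightarrow> real"
  where "\<And>n. c n \<in> I" "\<And>n. d n \<in> I" "\<And>n. c n < d n" "decseq c" "incseq d" "(\<Union>n. {c n<..d n}) = I"
proof
  define r where "r n = (q - p) / (real n + 3)" for n
  have r3: "3 * r n \<le> q - p" "0 < r n" for n
  proof -
    have "r n \<le> (q - p) / 3" unfolding r_def using pq by (intro divide_left_mono) auto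
    then show "3 * r n \<le> q - p" by simp
    show "0 < r n" using pq by (simp add: r_def)
  qed
  show "p + r n \<in> I" "q - r n \<in> I" "p + r n < q - r n" for n
    using r3[of n] by (auto simp: I_def)
  have "decseq r"
    unfolding r_def decseq_def using pq by (auto intro!: divide_left_mono mult_pos_pos)
  then show "decseq (\<lambda>n. p + r n)" "incseq (\<lambda>n. q - r n)"
    by (auto simp: decseq_def incseq_def)
  show "(\<Union>n. {p + r n<..q - r n}) = I"
  proof (intro set_eqI iffI)
    fix x assume "x \<in> I"
    define m where "m = min (x - p) (q - x)"
    have m: "m > 0" using \<open>x \<in> I\<close> by (simp add: m_def I_def)
    obtain n :: nat where "(q - p) / m < real n" using reals_Archimedean2 by blast
    then have "q - p < (real n + 3) * m" using m by (simp add: pos_divide_less_eq distrib_right)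
    then have "r n < m" by (simp add: r_def pos_divide_less_eq mult.commute)
    then show "x \<in> (\<Union>n. {p + r n<..q - r n})" by (auto simp: m_def intro!: exI[of _ n])
  next
    fix x assume "x \<in> (\<Union>n. {p + r n<..q - r n})"
    then obtain n where "x \<in> {p + r n<..q - r n}" by blast
    with r3(2)[of n] show "x \<in> I" by (simp add: I_def)
  qed
qed

lemma radon_sigma_finite:
  assumes M: "radon_measure_on I M"
  shows "sigma_finite_measure M"
proof (rule Ioc_exhaustion)
  fix c d :: "nat \<Rightarrow> real"
  assume cd: "\<And>n. c n \<in> I" "\<And>n. d n \<in> I" "(\<Union>n. {c n<..d n}) = I"
  let ?A = "range (\<lambda>n. {c n<..d n})"
  have "?A \<subseteq> sets M"
    using Ioc_subset(1)[OF cd(1,2)] by (auto simp: sets_radon_iff[OF M])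
  moreover have "emeasure M {c n<..d n} \<noteq> \<infinity>" for n
    using radon_finite_Ioc[OF M cd(1,2)] by (simp add: less_top)
  ultimately show ?thesis
    using cd(3) sets_radonD(2)[OF M] by (intro sigma_finite_measure.intro exI[of _ ?A]) simp_all
qed

lemma radon_sum_measure:
  assumes M: "radon_measure_on I M" and N: "radon_measure_on I N"
  shows "radon_measure_on I (sum_measure M N)"
    and "\<And>E. E \<in> sets borel \<Longrightarrow> E \<subseteq> I \<Longrightarrow> emeasure (sum_measure M N) E = emeasure M E + emeasure N E"
proof -
  have sets: "sets N = sets M" using sets_radonD(1)[OF M] sets_radonD(1)[OF N] by simp
  show *: "emeasure (sum_measure M N) E = emeasure M E + emeasure N E" if "E \<in> sets borel" "E \<subseteq> I" for E
    using that by (intro emeasure_sum_measure[OF sets]) (simp add: sets_radon_iff[OF M])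
  show "radon_measure_on I (sum_measure M N)"
  proof (rule radon_measure_onI)
    show "sets (sum_measure M N) = sets (restrict_space borel I)" using sets_radonD(1)[OF M] by simp
    show "emeasure (sum_measure M N) {a<..b} < \<infinity>" if "a \<in> I" "b \<in> I" "a < b" for a b
      using radon_finite_Ioc[OF M that(1,2)] radon_finite_Ioc[OF N that(1,2)] Ioc_subset(1)[OF that(1,2)]
      by (subst *) (auto simp: less_top)
  qed
qed

text \<open>The set function \<open>\<nu>\<close> is the signed Radon measure \<open>M1 - M2\<close>. Both measures may have infinite mass
  near the ends of \<open>I\<close>, so the difference is only taken on Borel sets that lie in a compact subset
  of \<open>I\<close>.\<close>

definition locally_difference :: "(real set \<Rightarrow> real) \<Rightarrow> real measure \<Rightarrow> real measure \<Rightarrow> bool" where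
  "locally_difference \<nu> M1 M2 \<longleftrightarrow> (\<forall>E K. E \<in> sets borel \<and> compact K \<and> E \<subseteq> K \<and> K \<subseteq> I \<longrightarrow>
     \<nu> E = measure M1 E - measure M2 E)"

lemma locally_differenceD:
  assumes "locally_difference \<nu> M1 M2" "E \<in> sets borel" "compact K" "E \<subseteq> K" "K \<subseteq> I"
  shows "\<nu> E = measure M1 E - measure M2 E"
  using assms unfolding locally_difference_def by blast

text \<open>With densities \<open>f1\<close> and \<open>f2\<close> of \<open>M1\<close> and \<open>M2\<close> with respect to \<open>M1 + M2\<close>, the two parts have
  the densities \<open>f1 - f2\<close> and \<open>f2 - f1\<close>, each cut off at \<open>0\<close>.\<close>

lemma hahn_jordan_exists:
  assumes M1: "radon_measure_on I M1" and M2: "radon_measure_on I M2"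
    and \<nu>: "locally_difference \<nu> M1 M2"
  shows "\<exists>P N. hahn_jordan_decomposition I \<nu> P N"
proof -
  define S where "S = sum_measure M1 M2"
  have S: "radon_measure_on I S"
    and S_eq: "\<And>E. E \<in> sets borel \<Longrightarrow> E \<subseteq> I \<Longrightarrow> emeasure S E = emeasure M1 E + emeasure M2 E"
    unfolding S_def using radon_sum_measure[OF M1 M2] by auto
  have ac: "absolutely_continuous S M1" "absolutely_continuous S M2"
    using S_eq unfolding absolutely_continuous_def null_sets_def
    by (auto simp: sets_radon_iff[OF S] sets_radon_iff[OF M1] sets_radon_iff[OF M2])
  have sets: "sets M1 = sets S" "sets M2 = sets S"
    using sets_radonD(1)[OF S] sets_radonD(1)[OF M1] sets_radonD(1)[OF M2] by auto
  interpret sigma_finite_measure S by (rule radon_sigma_finite[OF S])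
  obtain f1 where f1 [measurable]: "f1 \<in> borel_measurable S" "density S f1 = M1"
    using Radon_Nikodym[OF ac(1) sets(1)] by blast
  obtain f2 where f2 [measurable]: "f2 \<in> borel_measurable S" "density S f2 = M2"
    using Radon_Nikodym[OF ac(2) sets(2)] by blast
  \<comment> \<open>The case distinction keeps \<open>g1\<close> and \<open>g2\<close> equal to \<open>0\<close> where both densities are infinite;
    truncated subtraction would give \<open>\<infinity> - \<infinity> = \<infinity>\<close> there.\<close>
  define g1 where "g1 x = (if f2 x < f1 x then f1 x - f2 x else 0)" for x
  define g2 where "g2 x = (if f1 x < f2 x then f2 x - f1 x else 0)" for x
  have g [measurable]: "g1 \<in> borel_measurable S" "g2 \<in> borel_measurable S"
    unfolding g1_def g2_def by measurable
  define P where "P = density S g1"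
  define N where "N = density S g2"
  have "g1 x \<le> f1 x" "g2 x \<le> f2 x" for x by (auto simp: g1_def g2_def diff_le_self_ennreal)
  then have PN_le: "emeasure P E \<le> emeasure M1 E" "emeasure N E \<le> emeasure M2 E" if "E \<in> sets S" for E
    using that unfolding P_def N_def f1(2)[symmetric] f2(2)[symmetric]
    by (auto simp: emeasure_density intro!: nn_integral_mono mult_right_mono)
  have setsPN: "sets P = sets (restrict_space borel I)" "sets N = sets (restrict_space borel I)"
    using sets_radonD(1)[OF S] by (simp_all add: P_def N_def)
  have Ioc: "{a<..b} \<in> sets S" if "a \<in> I" "b \<in> I" for a b
    using Ioc_subset(1)[OF that] by (simp add: sets_radon_iff[OF S])
  have P: "radon_measure_on I P"
    by (rule radon_measure_onI[OF setsPN(1)])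
      (rule le_less_trans[OF PN_le(1)[OF Ioc] radon_finite_Ioc[OF M1]])
  have N: "radon_measure_on I N"
    by (rule radon_measure_onI[OF setsPN(2)])
      (rule le_less_trans[OF PN_le(2)[OF Ioc] radon_finite_Ioc[OF M2]])
  define A where "A = {x \<in> space S. f2 x < f1 x}"
  define B where "B = {x \<in> space S. f1 x < f2 x}"
  have AB: "A \<in> sets S" "B \<in> sets S" unfolding A_def B_def by measurable
  have IS: "space S = I" using sets_radonD(2)[OF S] .
  have nullP: "emeasure P (I - A) = 0"
  proof -
    have "(\<lambda>x. g1 x * indicator (I - A) x) = (\<lambda>_. 0)"
      by (auto simp: g1_def A_def IS indicator_def fun_eq_iff)
    moreover have "I - A \<in> sets S" using AB IS by (metis sets.compl_sets)
    ultimately show ?thesis unfolding P_def by (subst emeasure_density) simp_all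
  qed
  have nullN: "emeasure N (I - B) = 0"
  proof -
    have "(\<lambda>x. g2 x * indicator (I - B) x) = (\<lambda>_. 0)"
      by (auto simp: g2_def B_def IS indicator_def fun_eq_iff)
    moreover have "I - B \<in> sets S" using AB IS by (metis sets.compl_sets)
    ultimately show ?thesis unfolding N_def by (subst emeasure_density) simp_all
  qed
  \<comment> \<open>Both sides have the density \<open>max f1 f2\<close>, so no subtraction of infinite values is needed.\<close>
  have balance: "emeasure P E + emeasure M2 E = emeasure N E + emeasure M1 E" if E: "E \<in> sets S" for E
  proof -
    have "g1 x + f2 x = g2 x + f1 x" for x
      by (auto simp: g1_def g2_def diff_add_self_ennreal)
    then have *: "g1 x * indicator E x + f2 x * indicator E x = g2 x * indicator E x + f1 x * indicator E x" for x
      by (simp add: distrib_right[symmetric])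
    show ?thesis
      unfolding P_def N_def f1(2)[symmetric] f2(2)[symmetric] using E
      by (simp add: emeasure_density nn_integral_add[symmetric] *)
  qed
  have "hahn_jordan_decomposition I \<nu> P N"
    unfolding hahn_jordan_decomposition_def
  proof (intro conjI allI impI P N)
    have "A \<in> sets (restrict_space borel I)" "B \<in> sets (restrict_space borel I)"
      using AB sets_radonD(1)[OF S] by auto
    moreover have "A \<inter> B = {}" by (auto simp: A_def B_def)
    ultimately show "\<exists>A B. A \<in> sets (restrict_space borel I) \<and> B \<in> sets (restrict_space borel I) \<and>
        A \<inter> B = {} \<and> emeasure P (I - A) = 0 \<and> emeasure N (I - B) = 0"
      using nullP nullN by blast
    fix E K assume E: "E \<in> sets borel \<and> compact K \<and> E \<subseteq> K \<and> K \<subseteq> I"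
    then have ES: "E \<in> sets S" by (auto simp: sets_radon_iff[OF S])
    have fin: "emeasure L E \<noteq> top" if "radon_measure_on I L" for L
      using radon_finite_on_subset_compact[OF that, of K E] E by (auto simp: less_top)
    have "ennreal (measure P E + measure M2 E) = ennreal (measure N E + measure M1 E)"
      using balance[OF ES] fin[OF P] fin[OF N] fin[OF M1] fin[OF M2]
      by (simp add: emeasure_eq_ennreal_measure ennreal_plus)
    then have "measure P E + measure M2 E = measure N E + measure M1 E"
      by (subst (asm) ennreal_inj) auto
    moreover have "\<nu> E = measure M1 E - measure M2 E"
      using E by (intro locally_differenceD[OF \<nu>, of _ K]) auto
    ultimately show "\<nu> E = measure P E - measure N E" by linarith
  qed
  then show ?thesis by blast
qed

text \<open>The negative part is the smallest measure \<open>M2\<close> in a representation \<open>\<nu> = M1 - M2\<close>: on the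
  carrier \<open>B\<close> of \<open>N\<close>, where \<open>P\<close> vanishes, \<open>N = - \<nu> = M2 - M1 \<le> M2\<close>. Uniqueness follows by
  applying this to two decompositions in turn.\<close>

lemma hahn_jordan_minimal:
  assumes HJ: "hahn_jordan_decomposition I \<nu> P N"
    and M1: "radon_measure_on I M1" and M2: "radon_measure_on I M2"
    and \<nu>: "locally_difference \<nu> M1 M2"
    and E: "E \<in> sets borel" "compact K" "E \<subseteq> K" "K \<subseteq> I"
  shows "emeasure N E \<le> emeasure M2 E"
proof -
  from HJ obtain A B where P: "radon_measure_on I P" and N: "radon_measure_on I N"
    and AB: "A \<in> sets (restrict_space borel I)" "B \<in> sets (restrict_space borel I)" "A \<inter> B = {}"
      "emeasure P (I - A) = 0" "emeasure N (I - B) = 0"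
    and PN: "locally_difference \<nu> P N"
    unfolding hahn_jordan_decomposition_def locally_difference_def by blast
  have Ib: "I \<in> sets borel" by (simp add: I_def)
  have B: "B \<in> sets borel" "B \<subseteq> I" and A: "A \<in> sets borel" "A \<subseteq> I"
    using AB(1,2) by (auto simp: sets_restrict_space_iff I_def)
  let ?E = "E \<inter> B"
  have EB: "?E \<in> sets borel" "?E \<subseteq> K" "?E \<subseteq> I" using E B by auto
  have fin: "emeasure L ?E \<noteq> top" if "radon_measure_on I L" for L
    using radon_finite_on_subset_compact[OF that E(2,4) EB(2)] by (simp add: less_top)
  have "emeasure P ?E \<le> emeasure P (I - A)"
    using A B AB(3) Ib by (intro emeasure_mono) (auto simp: sets_radon_iff[OF P])
  then have "measure P ?E = 0" using AB(4) by (simp add: measure_def)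
  moreover have "\<nu> ?E = measure P ?E - measure N ?E" "\<nu> ?E = measure M1 ?E - measure M2 ?E"
    using locally_differenceD[OF PN EB(1) E(2) EB(2) E(4)]
      locally_differenceD[OF \<nu> EB(1) E(2) EB(2) E(4)] by auto
  ultimately have le: "measure N ?E \<le> measure M2 ?E"
    using measure_nonneg[of M1 ?E] by linarith
  have "emeasure N E \<le> emeasure N (?E \<union> (I - B))"
    using E B Ib by (intro emeasure_mono) (auto simp: sets_radon_iff[OF N])
  also have "\<dots> \<le> emeasure N ?E + emeasure N (I - B)"
    using EB B Ib by (intro emeasure_subadditive) (auto simp: sets_radon_iff[OF N])
  also have "\<dots> = ennreal (measure N ?E)" using AB(5) fin[OF N] by (simp add: emeasure_eq_ennreal_measure)
  also have "\<dots> \<le> ennreal (measure M2 ?E)" using le by (rule ennreal_leI)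
  also have "\<dots> = emeasure M2 ?E" using fin[OF M2] by (simp add: emeasure_eq_ennreal_measure)
  also have "\<dots> \<le> emeasure M2 E"
    using E by (intro emeasure_mono) (auto simp: sets_radon_iff[OF M2])
  finally show ?thesis .
qed

lemma hahn_jordanD:
  assumes "hahn_jordan_decomposition I \<nu> P N"
  shows "radon_measure_on I P" "radon_measure_on I N" "locally_difference \<nu> P N"
  using assms unfolding hahn_jordan_decomposition_def locally_difference_def by blast+

lemma hahn_jordan_neg_unique:
  assumes HJ: "hahn_jordan_decomposition I \<nu> P N" and HJ': "hahn_jordan_decomposition I \<nu> P' N'"
  shows "N' = N"
proof (rule radon_measure_eqI)
  show "radon_measure_on I N'" "radon_measure_on I N"
    using HJ HJ' by (auto dest: hahn_jordanD)
  fix a b assume "a \<in> I" "b \<in> I" "a < b"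
  then have "{a..b} \<subseteq> I" by (auto simp: I_def)
  then show "emeasure N' {a<..b} = emeasure N {a<..b}"
    using hahn_jordan_minimal[OF HJ hahn_jordanD[OF HJ'], of "{a<..b}" "{a..b}"]
      hahn_jordan_minimal[OF HJ' hahn_jordanD[OF HJ], of "{a<..b}" "{a..b}"]
    by (intro antisym) (auto simp: subset_iff)
qed

lemma D2_neg_eq:
  assumes "hahn_jordan_decomposition I (D2 I h) P N"
  shows "D2_neg I h = N"
  unfolding D2_neg_def
  using assms hahn_jordan_neg_unique[OF assms] by (intro the_equality) blast+

text \<open>The second derivative may be computed from any convex summand \<open>s\<close>. For another one \<open>t\<close>, the
  functions \<open>(h + s) + t\<close> and \<open>(h + t) + s\<close> agree, so their right derivatives and hence the sums of
  the corresponding measures agree.\<close>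

lemma D2_eq:
  assumes s: "convex_on I s" and hs: "convex_on I (\<lambda>x. h x + s x)"
  shows "locally_difference (D2 I h) (convex_D2 I (\<lambda>x. h x + s x)) (convex_D2 I s)"
  unfolding locally_difference_def
proof (intro allI impI)
  fix E K assume E: "E \<in> sets borel \<and> compact K \<and> E \<subseteq> K \<and> K \<subseteq> I"
  then have EI: "E \<subseteq> I" by blast
  define t where "t = (SOME s. convex_on I s \<and> convex_on I (\<lambda>x. h x + s x))"
  have "convex_on I t \<and> convex_on I (\<lambda>x. h x + t x)"
    unfolding t_def by (rule someI[of _ s]) (use s hs in blast)
  then have t: "convex_on I t" and ht: "convex_on I (\<lambda>x. h x + t x)" by auto
  have "open I" by (simp add: I_def)
  note R = convex_right_derivative(1)[OF \<open>open I\<close>]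
  note D = convex_D2(1)[OF s] convex_D2(1)[OF hs] convex_D2(1)[OF t] convex_D2(1)[OF ht]
  have "sum_measure (convex_D2 I (\<lambda>x. h x + t x)) (convex_D2 I s)
      = sum_measure (convex_D2 I (\<lambda>x. h x + s x)) (convex_D2 I t)"
  proof (rule radon_measure_eqI)
    fix a b assume ab: "a \<in> I" "b \<in> I" "a < b"
    have eq: "right_deriv (\<lambda>x. h x + t x) x + right_deriv s x
        = right_deriv (\<lambda>x. h x + s x) x + right_deriv t x" if "x \<in> I" for x
    proof -
      have "right_deriv (\<lambda>x. h x + s x + t x) x = right_deriv (\<lambda>x. h x + t x) x + right_deriv s x"
        using DERIV_add[OF R[OF ht that] R[OF s that]]
        by (intro right_deriv_eq) (simp add: ac_simps)
      moreover have "right_deriv (\<lambda>x. h x + s x + t x) x = right_deriv (\<lambda>x. h x + s x) x + right_deriv t x"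
        using DERIV_add[OF R[OF hs that] R[OF t that]] by (rule right_deriv_eq)
      ultimately show ?thesis by simp
    qed
    have mono: "right_deriv f a \<le> right_deriv f b" if "convex_on I f" for f
      using convex_right_deriv_mono[OF \<open>open I\<close> that ab(1,2)] ab(3) by simp
    have meas: "{a<..b} \<in> sets borel" "{a<..b} \<subseteq> I" using Ioc_subset(1)[OF ab(1,2)] by auto
    show "emeasure (sum_measure (convex_D2 I (\<lambda>x. h x + t x)) (convex_D2 I s)) {a<..b}
      = emeasure (sum_measure (convex_D2 I (\<lambda>x. h x + s x)) (convex_D2 I t)) {a<..b}"
      using eq[OF ab(1)] eq[OF ab(2)] mono[OF s] mono[OF hs] mono[OF t] mono[OF ht]
      by (simp add: radon_sum_measure(2)[OF D(4,1) meas] radon_sum_measure(2)[OF D(2,3) meas]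
          convex_D2(2)[OF s ab] convex_D2(2)[OF hs ab] convex_D2(2)[OF t ab] convex_D2(2)[OF ht ab]
          ennreal_plus[symmetric] del: ennreal_plus)
  qed (intro radon_sum_measure(1) D)+
  then have "emeasure (convex_D2 I (\<lambda>x. h x + t x)) E + emeasure (convex_D2 I s) E
      = emeasure (convex_D2 I (\<lambda>x. h x + s x)) E + emeasure (convex_D2 I t) E"
    using radon_sum_measure(2)[OF D(4,1) _ EI] radon_sum_measure(2)[OF D(2,3) _ EI] E by simp
  moreover have fin: "emeasure L E \<noteq> top" if "radon_measure_on I L" for L
    using radon_finite_on_subset_compact[OF that, of K E] E by (auto simp: less_top)
  ultimately have "ennreal (measure (convex_D2 I (\<lambda>x. h x + t x)) E + measure (convex_D2 I s) E)
      = ennreal (measure (convex_D2 I (\<lambda>x. h x + s x)) E + measure (convex_D2 I t) E)"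
    using fin[OF D(1)] fin[OF D(2)] fin[OF D(3)] fin[OF D(4)]
    by (simp add: emeasure_eq_ennreal_measure ennreal_plus)
  then have "measure (convex_D2 I (\<lambda>x. h x + t x)) E + measure (convex_D2 I s) E
      = measure (convex_D2 I (\<lambda>x. h x + s x)) E + measure (convex_D2 I t) E"
    by (subst (asm) ennreal_inj) auto
  then show "D2 I h E = measure (convex_D2 I (\<lambda>x. h x + s x)) E - measure (convex_D2 I s) E"
    unfolding D2_def Let_def t_def[symmetric] by linarith
qed

end

section \<open>Extending convexity to the endpoints\<close>

text \<open>Upper semicontinuity at the endpoints suffices, as the values there only enter on the larger
  side of the convexity inequality.\<close>

lemma convex_on_Icc_if_upper_semicontinuous:
  fixes g :: "real \<Rightarrow> real"
  assumes "p < q" and g: "convex_on {p<..<q} g"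
    and usc_p: "\<And>e. e > 0 \<Longrightarrow> \<forall>\<^sub>F x in at_right p. g x < g p + e"
    and usc_q: "\<And>e. e > 0 \<Longrightarrow> \<forall>\<^sub>F x in at_left q. g x < g q + e"
  shows "convex_on {p..q} g"
proof (rule convex_on_linorderI)
  define m where "m = (p + q) / 2"
  have m: "p < m" "m < q" using \<open>p < q\<close> by (auto simp: m_def)
  \<comment> \<open>All points are moved towards the midpoint; inside the interval convexity is available.\<close>
  define mv where "mv x d = (1 - d) * x + d * m" for x d :: real
  have inside: "mv x d \<in> {p<..<q}" if "x \<in> {p..q}" "0 < d" "d < 1" for x d
  proof -
    have "(1 - d) * p + d * p < (1 - d) * x + d * m" "(1 - d) * x + d * m < (1 - d) * q + d * q"
      using that m by (auto intro!: add_le_less_mono mult_left_mono mult_strict_left_mono)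
    then show ?thesis by (simp add: mv_def algebra_simps)
  qed
  have ev: "\<forall>\<^sub>F d in at_right 0. d \<in> {0<..<1::real}"
    by (rule eventually_at_right_real) simp
  have lim: "(mv x \<longlongrightarrow> x) (at_right 0)" for x
  proof -
    have "((\<lambda>d. (1 - d) * x + d * m) \<longlongrightarrow> (1 - 0) * x + 0 * m) (at_right 0)"
      by (intro tendsto_intros)
    then show ?thesis by (simp add: mv_def[abs_def])
  qed
  have cont: "((\<lambda>d. g (mv x d)) \<longlongrightarrow> g x) (at_right 0)" if "x \<in> {p<..<q}" for x
  proof -
    have "isCont g x"
      using convex_on_continuous[OF open_greaterThanLessThan g] that
      by (simp add: continuous_on_eq_continuous_at)
    then show ?thesis using lim by (rule isCont_tendsto_compose)
  qed
  have usc: "\<forall>\<^sub>F d in at_right 0. g (mv x d) < g x + e" if x: "x \<in> {p..q}" and "e > 0" for x e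
  proof -
    consider "x = p" | "x = q" | "x \<in> {p<..<q}" using x by fastforce
    then show ?thesis
    proof cases
      case 1
      have "filterlim (mv x) (at_right p) (at_right 0)"
        unfolding filterlim_at
      proof
        show "\<forall>\<^sub>F d in at_right 0. mv x d \<in> {p<..} \<and> mv x d \<noteq> p"
          using ev by eventually_elim (use inside[OF x] in force)
        show "(mv x \<longlongrightarrow> p) (at_right 0)" using lim[of x] 1 by simp
      qed
      with usc_p[OF \<open>e > 0\<close>] show ?thesis unfolding 1 by (rule eventually_compose_filterlim)
    next
      case 2
      have "filterlim (mv x) (at_left q) (at_right 0)"
        unfolding filterlim_at
      proof
        show "\<forall>\<^sub>F d in at_right 0. mv x d \<in> {..<q} \<and> mv x d \<noteq> q"
          using ev by eventually_elim (use inside[OF x] in force)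
        show "(mv x \<longlongrightarrow> q) (at_right 0)" using lim[of x] 2 by simp
      qed
      with usc_q[OF \<open>e > 0\<close>] show ?thesis unfolding 2 by (rule eventually_compose_filterlim)
    next
      case 3
      from cont[OF this] show ?thesis by (rule order_tendstoD(2)) (use \<open>e > 0\<close> in simp)
    qed
  qed
  fix t x y :: real assume t: "0 < t" "t < 1" and xy: "x \<in> {p..q}" "y \<in> {p..q}" "x < y"
  define z where "z = (1 - t) * x + t * y"
  have "(1 - t) * x + t * x < z" "z < (1 - t) * y + t * y"
    unfolding z_def using t xy by (auto intro!: add_strict_left_mono add_strict_right_mono)
  then have "x < z" "z < y" by (simp_all add: algebra_simps)
  with xy have z: "z \<in> {p<..<q}" by simp
  have "g z \<le> (1 - t) * g x + t * g y + e" if "e > 0" for e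
  proof (rule tendsto_upperbound[OF cont[OF z]])
    show "\<forall>\<^sub>F d in at_right 0. g (mv z d) \<le> (1 - t) * g x + t * g y + e"
      using ev usc[OF xy(1) that] usc[OF xy(2) that]
    proof eventually_elim
      case (elim d)
      have "mv z d = (1 - t) *\<^sub>R mv x d + t *\<^sub>R mv y d"
        by (simp add: mv_def z_def algebra_simps)
      then have "g (mv z d) \<le> (1 - t) * g (mv x d) + t * g (mv y d)"
        using convex_onD[OF g, of t "mv x d" "mv y d"] t inside xy elim by simp
      also have "\<dots> \<le> (1 - t) * (g x + e) + t * (g y + e)"
        using t elim by (intro add_mono mult_left_mono) auto
      also have "\<dots> = (1 - t) * g x + t * g y + e" by (simp add: algebra_simps)
      finally show ?case .
    qed
  qed simp
  then have "g z \<le> (1 - t) * g x + t * g y" by (rule field_le_epsilon)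
  then show "g ((1 - t) *\<^sub>R x + t *\<^sub>R y) \<le> (1 - t) * g x + t * g y" by (simp add: z_def)
qed simp

section \<open>The two inequalities\<close>

context bounded_open_interval
begin

lemma hahn_jordan_neg_le_lipschitz:
  assumes HJ: "hahn_jordan_decomposition I (D2 I h) P N"
    and lip: "L-lipschitz_on I s" and s: "convex_on I s" and hs: "convex_on I (\<lambda>x. h x + s x)"
  shows "emeasure N I \<le> ennreal (2 * L)"
proof (rule Ioc_exhaustion)
  fix c d :: "nat \<Rightarrow> real"
  assume cd: "\<And>n. c n \<in> I" "\<And>n. d n \<in> I" "\<And>n. c n < d n" "decseq c" "incseq d"
    "(\<Union>n. {c n<..d n}) = I"
  have "open I" by (simp add: I_def)
  have N: "radon_measure_on I N" using HJ by (rule hahn_jordanD)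
  have slope: "- L \<le> (s y - s x) / (y - x)" "(s y - s x) / (y - x) \<le> L"
    if "x \<in> I" "y \<in> I" "x < y" for x y
    using lipschitz_onD[OF lip that(2,1)] that(3)
    by (auto simp: dist_real_def pos_le_divide_eq pos_divide_le_eq)
  have bound: "- L \<le> right_deriv s x" "right_deriv s x \<le> L" if x: "x \<in> I" for x
  proof -
    have w: "(p + x) / 2 \<in> I" "(p + x) / 2 < x" and y: "(x + q) / 2 \<in> I" "x < (x + q) / 2"
      using x by (auto simp: I_def)
    show "- L \<le> right_deriv s x"
      using slope(1)[OF w(1) x w(2)] convex_slope_le_right_deriv[OF \<open>open I\<close> s w(1) x w(2)] by linarith
    show "right_deriv s x \<le> L"
      using slope(2)[OF x y] convex_right_derivative(2)[OF \<open>open I\<close> s x y] by linarith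
  qed
  have "emeasure N {c n<..d n} \<le> ennreal (2 * L)" for n
  proof -
    have "emeasure N {c n<..d n} \<le> emeasure (convex_D2 I s) {c n<..d n}"
      using Ioc_subset(2)[OF cd(1,2)]
      by (intro hahn_jordan_minimal[OF HJ convex_D2(1)[OF hs] convex_D2(1)[OF s] D2_eq[OF s hs],
            where K="{c n..d n}"]) auto
    also have "\<dots> = ennreal (right_deriv s (d n) - right_deriv s (c n))"
      by (rule convex_D2(2)[OF s cd(1-3)])
    also have "\<dots> \<le> ennreal (2 * L)"
      using bound(2)[OF cd(2), of n] bound(1)[OF cd(1), of n] by (intro ennreal_leI) linarith
    finally show ?thesis .
  qed
  then have "(SUP n. emeasure N {c n<..d n}) \<le> ennreal (2 * L)" by (rule SUP_least)
  also have "(SUP n. emeasure N {c n<..d n}) = emeasure N (\<Union>n. {c n<..d n})"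
  proof (rule SUP_emeasure_incseq)
    show "range (\<lambda>n. {c n<..d n}) \<subseteq> sets N"
      using Ioc_subset(1)[OF cd(1,2)] by (auto simp: sets_radon_iff[OF N])
    show "incseq (\<lambda>n. {c n<..d n})"
    proof (rule incseq_SucI)
      fix n
      have "c (Suc n) \<le> c n" "d n \<le> d (Suc n)"
        using decseq_SucD[OF cd(4)] incseq_SucD[OF cd(5)] by auto
      then show "{c n<..d n} \<subseteq> {c (Suc n)<..d (Suc n)}" by auto
    qed
  qed
  finally show "emeasure N I \<le> ennreal (2 * L)" by (simp add: cd(6))
qed

text \<open>The optimal convex summand: its derivative is the distribution function of the negative
  part, shifted so that it ranges symmetrically about \<open>0\<close>.\<close>

lemma optimal_convex_summand:
  assumes HJ: "hahn_jordan_decomposition I (D2 I h) P N"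
    and fin: "emeasure N I < \<infinity>"
    and v: "convex_on I v" and hv: "convex_on I (\<lambda>x. h x + v x)"
  obtains s where "(measure N I / 2)-lipschitz_on {p..q} s" "convex_on {p..q} s"
    "convex_on I (\<lambda>x. h x + s x)"
proof
  have P: "radon_measure_on I P" and N: "radon_measure_on I N"
    and PN: "locally_difference (D2 I h) P N"
    using hahn_jordanD[OF HJ] .
  have spN: "space N = I" by (rule sets_radonD(2)[OF N])
  define N' where "N' = distr N borel (\<lambda>x. x)"
  have id: "(\<lambda>x. x) \<in> N \<rightarrow>\<^sub>M borel"
    by (rule measurableI) (auto simp: sets_radon_iff[OF N] spN I_def)
  have N': "emeasure N' E = emeasure N (E \<inter> I)" if "E \<in> sets borel" for E
    unfolding N'_def by (subst emeasure_distr[OF id that]) (simp add: spN)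
  then have mN': "measure N' E = measure N (E \<inter> I)" if "E \<in> sets borel" for E
    using that by (simp add: measure_def)
  have spN': "space N' = UNIV" and sN': "sets N' = sets borel" by (simp_all add: N'_def)
  interpret F: finite_borel_measure N'
  proof (intro finite_borel_measure.intro finite_borel_measure_axioms.intro finite_measureI)
    show "emeasure N' (space N') \<noteq> \<infinity>" using fin by (simp add: spN' N' less_top)
    show "sets N' = sets borel" by (rule sN')
  qed
  define M where "M = measure N I"
  \<comment> \<open>The measure \<open>N\<close> is extended by \<open>0\<close> to the real line, so \<open>cdf N' x\<close> is \<open>N(p, x]\<close>.\<close>
  define k where "k x = cdf N' x - M / 2" for x
  have mono: "k x \<le> k y" if "x \<le> y" for x y
    using F.cdf_nondecreasing[OF that] by (simp add: k_def)
  have bound: "- (M / 2) \<le> k x" "k x \<le> M / 2" for x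
    using F.cdf_nonneg[of x] F.cdf_bounded[of x] by (simp_all add: k_def M_def spN' mN')
  have k_cont: "(k \<longlongrightarrow> k x) (at_right x)" for x
    unfolding k_def using F.cdf_is_right_cont[of x]
    by (intro tendsto_diff tendsto_const) (simp add: continuous_within)
  have int: "k integrable_on {a..b}" for a b
    using mono by (intro integrable_on_mono_on) (auto simp: mono_on_def)
  define s where "s x = integral {p..x} k" for x
  have s_diff: "s y - s x = integral {x..y} k" if "p \<le> x" "x \<le> y" for x y
    using Henstock_Kurzweil_Integration.integral_combine[OF that int] by (simp add: s_def)
  have s_lo: "k x * (y - x) \<le> s y - s x" and s_hi: "s y - s x \<le> k y * (y - x)"
    if "p \<le> x" "x \<le> y" for x y
  proof -
    have "integral {x..y} (\<lambda>_. k x) \<le> integral {x..y} k"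
      using mono by (intro integral_le int) auto
    then show "k x * (y - x) \<le> s y - s x" using that by (simp add: s_diff mult.commute)
    have "integral {x..y} k \<le> integral {x..y} (\<lambda>_. k y)"
      using mono by (intro integral_le int) auto
    then show "s y - s x \<le> k y * (y - x)" using that by (simp add: s_diff mult.commute)
  qed
  show "convex_on {p..q} s"
  proof (rule convex_on_subgradientI)
    fix x y assume "x \<in> {p..q}" "y \<in> {p..q}"
    then show "s x + k x * (y - x) \<le> s y"
      using s_lo[of x y] s_hi[of y x] by (cases "x \<le> y") (auto simp: algebra_simps)
  qed simp
  show lip: "(measure N I / 2)-lipschitz_on {p..q} s"
    unfolding M_def[symmetric]
  proof (rule lipschitz_on_leI)
    fix x y assume xy: "x \<in> {p..q}" "y \<in> {p..q}" "x \<le> y"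
    have "- (M / 2) * (y - x) \<le> k x * (y - x)" "k y * (y - x) \<le> M / 2 * (y - x)"
      using bound[of x] bound[of y] xy by (intro mult_right_mono; simp)+
    moreover have "k x * (y - x) \<le> s y - s x" "s y - s x \<le> k y * (y - x)"
      using s_lo[of x y] s_hi[of x y] xy by auto
    ultimately have "\<bar>s y - s x\<bar> \<le> M / 2 * (y - x)" by linarith
    then show "dist (s x) (s y) \<le> M / 2 * dist x y"
      using xy by (simp add: dist_real_def abs_minus_commute)
  qed (simp add: M_def)
  have s_deriv: "(s has_real_derivative k x) (at_right x)" if "p \<le> x" for x
    unfolding right_derivative_iff
  proof (rule tendsto_sandwich[OF _ _ tendsto_const k_cont])
    have ev: "\<forall>\<^sub>F y in at_right x. x < y" by (rule eventually_at_right_less)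
    from ev show "\<forall>\<^sub>F y in at_right x. k x \<le> (s y - s x) / (y - x)"
      by eventually_elim (simp add: s_lo that pos_le_divide_eq)
    from ev show "\<forall>\<^sub>F y in at_right x. (s y - s x) / (y - x) \<le> k y"
      by eventually_elim (simp add: s_hi that pos_divide_le_eq)
  qed
  have "open I" by (simp add: I_def)
  note R = convex_right_derivative(1)[OF \<open>open I\<close>]
  \<comment> \<open>\<open>r\<close> is the right derivative of \<open>h + s\<close>; its increments are masses of \<open>P\<close>.\<close>
  define r where "r x = right_deriv (\<lambda>x. h x + v x) x - right_deriv v x + k x" for x
  show "convex_on I (\<lambda>x. h x + s x)"
  proof (rule convex_on_mono_right_derivative)
    show "convex I" by (simp add: I_def)
    have "I \<subseteq> {p..q}" by (auto simp: I_def)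
    then have "continuous_on I s"
      using continuous_on_subset[OF lipschitz_on_continuous_on[OF lip]] by blast
    then have "continuous_on I (\<lambda>x. (h x + v x) - v x + s x)"
      by (intro continuous_on_add[OF continuous_on_diff]
          convex_on_continuous[OF \<open>open I\<close> hv] convex_on_continuous[OF \<open>open I\<close> v])
    then show "continuous_on I (\<lambda>x. h x + s x)" by simp
    show "((\<lambda>x. h x + s x) has_real_derivative r x) (at_right x)" if x: "x \<in> I" for x
    proof -
      have "((\<lambda>x. (h x + v x) - v x + s x) has_real_derivative r x) (at_right x)"
        unfolding r_def using x by (intro DERIV_add DERIV_diff R hv v s_deriv) (auto simp: I_def)
      then show ?thesis by simp
    qed
    fix a b assume ab: "a \<in> I" "b \<in> I" "a \<le> b"
    show "r a \<le> r b"
    proof (cases "a = b")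
      case False
      with ab have "a < b" by simp
      have sub: "{a<..b} \<subseteq> {a..b}" "{a..b} \<subseteq> I" "{a<..b} \<inter> I = {a<..b}"
        using ab by (auto simp: I_def)
      have inc: "measure (convex_D2 I f) {a<..b} = right_deriv f b - right_deriv f a"
        if "convex_on I f" for f
        using convex_D2(2)[OF that ab(1,2) \<open>a < b\<close>] convex_right_deriv_mono[OF \<open>open I\<close> that ab]
        by (simp add: measure_def)
      have "k b - k a = measure N {a<..b}"
        using F.cdf_diff_eq[OF \<open>a < b\<close>] sub(3) by (simp add: k_def mN')
      moreover note locally_differenceD[OF PN greaterThanAtMost_borel compact_Icc sub(1,2)]
        locally_differenceD[OF D2_eq[OF v hv] greaterThanAtMost_borel compact_Icc sub(1,2)]
      ultimately have "r b - r a = measure P {a<..b}"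
        unfolding inc[OF v] inc[OF hv] r_def by linarith
      then show ?thesis using measure_nonneg[of P "{a<..b}"] by linarith
    qed simp
  qed
qed

end

lemma eventually_less_add_if_Limsup_le:
  fixes h :: "'a \<Rightarrow> real"
  assumes "Limsup F (\<lambda>x. ereal (h x)) \<le> ereal c" "(s \<longlongrightarrow> l) F" "e > 0"
  shows "\<forall>\<^sub>F x in F. h x + s x < c + l + e"
proof -
  have "Limsup F (\<lambda>x. ereal (h x)) < ereal (c + e / 2)"
    using assms(1,3) by (auto intro: le_less_trans)
  then have "\<forall>\<^sub>F x in F. ereal (h x) < ereal (c + e / 2)" by (rule Limsup_lessD)
  moreover have "\<forall>\<^sub>F x in F. s x < l + e / 2" using assms by (intro order_tendstoD) auto
  ultimately show ?thesis by eventually_elim auto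
qed

theorem theorem5p7:
  fixes p q :: real and h :: "real \<Rightarrow> real"
  assumes "p < q"
    and "difference_of_convex {p..q} h"
    and "Limsup (at_right p) (\<lambda>x. ereal (h x)) \<le> ereal (h p)"
    and "Limsup (at_left q) (\<lambda>x. ereal (h x)) \<le> ereal (h q)"
  shows "concave_deviation {p..q} h = emeasure (D2_neg {p<..<q} h) {p<..<q} / 2"
proof -
  define I where "I = {p<..<q}"
  interpret bounded_open_interval p q I by unfold_locales (simp_all add: \<open>p < q\<close> I_def)
  have I: "I \<subseteq> {p..q}" "convex I" by (auto simp: I_def)
  obtain v where "convex_on {p..q} v" "convex_on {p..q} (\<lambda>x. h x + v x)"
    using assms(2) unfolding difference_of_convex_def by blast
  then have v: "convex_on I v" and hv: "convex_on I (\<lambda>x. h x + v x)"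
    using I by (blast intro: convex_on_subset)+
  obtain P N where HJ: "hahn_jordan_decomposition I (D2 I h) P N"
    using hahn_jordan_exists[OF convex_D2(1)[OF hv] convex_D2(1)[OF v] D2_eq[OF v hv]] by blast
  have N: "D2_neg I h = N" by (rule D2_neg_eq[OF HJ])
  have half: "ennreal (2 * x) / 2 = ennreal x" if "x \<ge> 0" for x
    using that by (simp add: divide_ennreal[symmetric] ennreal_divide_numeral)
  have "emeasure N I / 2 \<le> concave_deviation {p..q} h"
    unfolding concave_deviation_def
  proof (rule Inf_greatest)
    fix l assume "l \<in> {ennreal L | L s. L-lipschitz_on {p..q} s \<and> convex_on {p..q} s
      \<and> convex_on {p..q} (\<lambda>x. h x + s x)}"
    then obtain L s where l: "l = ennreal L" and s: "L-lipschitz_on {p..q} s" "convex_on {p..q} s"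
      "convex_on {p..q} (\<lambda>x. h x + s x)" by blast
    have "emeasure N I \<le> ennreal (2 * L)"
      by (rule hahn_jordan_neg_le_lipschitz[OF HJ lipschitz_on_subset[OF s(1) I(1)]
            convex_on_subset[OF s(2) I] convex_on_subset[OF s(3) I]])
    then have "emeasure N I / 2 \<le> ennreal (2 * L) / 2" by (rule divide_right_mono_ennreal)
    also have "\<dots> = l" using lipschitz_on_nonneg[OF s(1)] by (simp add: half l)
    finally show "emeasure N I / 2 \<le> l" .
  qed
  moreover have "concave_deviation {p..q} h \<le> emeasure N I / 2"
  proof (cases "emeasure N I < \<infinity>")
    case True
    obtain s where s: "(measure N I / 2)-lipschitz_on {p..q} s" "convex_on {p..q} s"
      "convex_on I (\<lambda>x. h x + s x)"
      by (rule optimal_convex_summand[OF HJ True v hv])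
    have cont: "continuous_on {p..q} s" by (rule lipschitz_on_continuous_on[OF s(1)])
    have "convex_on {p..q} (\<lambda>x. h x + s x)"
      using \<open>p < q\<close> s(3)[unfolded I_def]
    proof (rule convex_on_Icc_if_upper_semicontinuous)
      fix e :: real assume "e > 0"
      show "\<forall>\<^sub>F x in at_right p. h x + s x < h p + s p + e"
        by (rule eventually_less_add_if_Limsup_le[OF assms(3) continuous_on_Icc_at_rightD[OF cont \<open>p < q\<close>] \<open>e > 0\<close>])
      show "\<forall>\<^sub>F x in at_left q. h x + s x < h q + s q + e"
        by (rule eventually_less_add_if_Limsup_le[OF assms(4) continuous_on_Icc_at_leftD[OF cont \<open>p < q\<close>] \<open>e > 0\<close>])
    qed
    then have "concave_deviation {p..q} h \<le> ennreal (measure N I / 2)"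
      unfolding concave_deviation_def using s(1,2) by (intro Inf_lower) blast
    also have "\<dots> = ennreal (2 * (measure N I / 2)) / 2" by (rule half[symmetric]) simp
    also have "\<dots> = emeasure N I / 2" using True by (simp add: emeasure_eq_ennreal_measure less_top)
    finally show ?thesis .
  next
    case False
    then have "emeasure N I = \<infinity>" by (simp add: less_top[symmetric])
    then show ?thesis by (simp add: ennreal_top_divide)
  qed
  ultimately show ?thesis using N by (simp add: I_def)
qed

end
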